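(* Let $R$ be a ring. Then $R$ is uniquely $\pi$-clean if and only if both of the following hold: (1) $R$ is an exchange ring. (2) $R/J^*(R)$ is potent and every idempotent uniquely lifts modulo $J^*(R)$.
   Context: All rings are associative with identity, not necessarily commutative. $\mathbb{N}$ denotes the positive integers. $J^*(R)$ denotes the intersection of all maximal (two-sided) ideals of $R$. A ring $R$ is an exchange ring if for any $a\in R$ there exists an idempotent $e\in aR$ such that $1-e\in(1-a)R$. A ring $T$ is potent if for any $a\in T$ there exists an integer $n\geq 2$ such that $a^n=a$. Every idempotent uniquely lifts modulo $J^*(R)$ means: for every $a\in R$ with $a-a^2\in J^*(R)$ there is a unique idempotent $f\in R$ with $a-f\in J^*(R)$. An element $x$ of a ring $R$ is uniquely clean if it can be written in exactly one way as $x=e+u$ with $e\in R$ an idempotent and $u\in R$ a unit. A ring $R$ is uniquely $\pi$-clean if for every $a\in R$ there exists $n\in\mathbb{N}$ such that $a^n$ is uniquely clean. *)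

theory Defs
  imports "HOL-Algebra.Algebra"
begin

text \<open>Rings are HOL-Algebra rings: unital, not necessarily commutative, possibly trivial.
  All ideals are two-sided, as in the library.\<close>

definition idempotents :: "('a, 'm) ring_scheme \<Rightarrow> 'a set" where
  "idempotents R = {e \<in> carrier R. e \<otimes>\<^bsub>R\<^esub> e = e}"

text \<open>The intersection with the carrier only matters when there is no maximal ideal, i.e. for the
  trivial ring, where the empty intersection has to be read as the whole ring.\<close>

definition Jstar :: "('a, 'm) ring_scheme \<Rightarrow> 'a set" where
  "Jstar R = carrier R \<inter> \<Inter> {M. maximalideal M R}"

text \<open>The set \<open>a <#\<^bsub>R\<^esub> carrier R\<close> is the principal right ideal \<open>aR\<close>.\<close>

definition exchange_ring :: "('a, 'm) ring_scheme \<Rightarrow> bool" where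
  "exchange_ring R \<longleftrightarrow>
     ring R \<and>
     (\<forall>a \<in> carrier R. \<exists>e \<in> idempotents R.
        e \<in> a <#\<^bsub>R\<^esub> carrier R \<and>
        \<one>\<^bsub>R\<^esub> \<ominus>\<^bsub>R\<^esub> e \<in> (\<one>\<^bsub>R\<^esub> \<ominus>\<^bsub>R\<^esub> a) <#\<^bsub>R\<^esub> carrier R)"

definition potent_ring :: "('a, 'm) ring_scheme \<Rightarrow> bool" where
  "potent_ring T \<longleftrightarrow>
     ring T \<and> (\<forall>a \<in> carrier T. \<exists>n::nat. n \<ge> 2 \<and> a [^]\<^bsub>T\<^esub> n = a)"

definition idempotents_lift_uniquely_mod :: "('a, 'm) ring_scheme \<Rightarrow> 'a set \<Rightarrow> bool" where
  "idempotents_lift_uniquely_mod R I \<longleftrightarrow>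
     (\<forall>a \<in> carrier R. a \<ominus>\<^bsub>R\<^esub> a [^]\<^bsub>R\<^esub> (2::nat) \<in> I \<longrightarrow>
        (\<exists>!f. f \<in> idempotents R \<and> a \<ominus>\<^bsub>R\<^esub> f \<in> I))"

definition uniquely_clean :: "('a, 'm) ring_scheme \<Rightarrow> 'a \<Rightarrow> bool" where
  "uniquely_clean R x \<longleftrightarrow>
     (\<exists>!p. p \<in> idempotents R \<times> Units R \<and> x = fst p \<oplus>\<^bsub>R\<^esub> snd p)"

definition uniquely_pi_clean_ring :: "('a, 'm) ring_scheme \<Rightarrow> bool" where
  "uniquely_pi_clean_ring R \<longleftrightarrow>
     ring R \<and>
     (\<forall>a \<in> carrier R. \<exists>n::nat. n \<ge> 1 \<and> uniquely_clean R (a [^]\<^bsub>R\<^esub> n))"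

end

theory Submission
  imports Defs
begin

text \<open>
  Suppose \<open>R\<close> is uniquely \<open>\<pi>\<close>-clean. Idempotents are their own powers, hence uniquely clean, which
  forces them to be central. Modulo a maximal ideal \<open>M\<close> every idempotent becomes \<open>0\<close> or \<open>1\<close>, so
  clean powers show that \<open>x\<close> or \<open>1 - x\<close> is always a unit of \<open>R/M\<close>; a simple local ring is a
  division ring. If \<open>a^n = e + u\<close> is the unique clean decomposition, then \<open>a^n\<close> agrees with
  \<open>1 - e\<close> modulo \<open>M\<close>, whence \<open>a^(n+1) - a\<close> lies in \<open>M\<close>, with \<open>n\<close> independent of \<open>M\<close>.

  Conversely, \<open>R/J*\<close> is reduced, so \<open>e\<close> and \<open>e + er(1-e)\<close> agree modulo \<open>J*\<close>, and unique lifting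
  makes idempotents central. Since \<open>J*\<close> contains no nonzero idempotent, exchange makes \<open>1 + J*\<close>
  consist of units. If \<open>a^(m+1)\<close> and \<open>a\<close> agree modulo \<open>J*\<close>, then \<open>a^m\<close> is an idempotent \<open>f\<close> modulo
  \<open>J*\<close>, and \<open>a^m = (1 - f) + (a^m - (1 - f))\<close> is its only clean decomposition.
\<close>

section \<open>Unique clean decompositions\<close>

lemma uniquely_cleanD:
  assumes "uniquely_clean R x"
    and "e \<in> idempotents R" "u \<in> Units R" "x = e \<oplus>\<^bsub>R\<^esub> u"
    and "f \<in> idempotents R" "v \<in> Units R" "x = f \<oplus>\<^bsub>R\<^esub> v"
  shows "e = f" "u = v"
proof -
  have "(e, u) = (f, v)"
    using assms(1) unfolding uniquely_clean_def
  proof (rule Uniq_D[OF conjunct2[OF iffD1[OF ex1_iff_ex_Uniq]]])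
    show "(e, u) \<in> idempotents R \<times> Units R \<and> x = fst (e, u) \<oplus>\<^bsub>R\<^esub> snd (e, u)"
      using assms by simp
    show "(f, v) \<in> idempotents R \<times> Units R \<and> x = fst (f, v) \<oplus>\<^bsub>R\<^esub> snd (f, v)"
      using assms(5-7) by simp
  qed
  then show "e = f" "u = v" by auto
qed

lemma uniquely_cleanE:
  assumes "uniquely_clean R x"
  obtains e u where "e \<in> idempotents R" "u \<in> Units R" "x = e \<oplus>\<^bsub>R\<^esub> u"
  using assms unfolding uniquely_clean_def by (auto simp: mem_Times_iff)

lemma uniquely_cleanI:
  assumes "e \<in> idempotents R" "u \<in> Units R" "x = e \<oplus>\<^bsub>R\<^esub> u"
    and "\<And>f v. f \<in> idempotents R \<Longrightarrow> v \<in> Units R \<Longrightarrow> x = f \<oplus>\<^bsub>R\<^esub> v \<Longrightarrow> f = e \<and> v = u"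
  shows "uniquely_clean R x"
  unfolding uniquely_clean_def
proof (rule ex1I[of _ "(e, u)"])
  show "(e, u) \<in> idempotents R \<times> Units R \<and> x = fst (e, u) \<oplus>\<^bsub>R\<^esub> snd (e, u)"
    using assms(1-3) by simp
  fix p assume p: "p \<in> idempotents R \<times> Units R \<and> x = fst p \<oplus>\<^bsub>R\<^esub> snd p"
  have "fst p = e \<and> snd p = u"
    by (rule assms(4)) (use p in auto)
  then show "p = (e, u)" by (simp add: prod_eq_iff)
qed

section \<open>Idempotents and their Peirce corners\<close>

context ring
begin

text \<open>The library does not give \<open>r_one\<close> to the \<open>algebra\<close> method for non-commutative rings.\<close>
declare r_one [algebra ring "Ring.zero R" "add R" "a_inv R" "a_minus R" "one R" "Group.mult R"]

lemma Units_of_two_sided: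
  assumes "x \<in> carrier R" "y \<in> carrier R" "z \<in> carrier R" "x \<otimes> y = \<one>" "z \<otimes> x = \<one>"
  shows "x \<in> Units R"
proof -
  have "z = y" using inv_unique[OF assms(5,4)] assms by auto
  then show ?thesis using assms by (auto simp: Units_def)
qed

lemma idempotentsI: "e \<in> carrier R \<Longrightarrow> e \<otimes> e = e \<Longrightarrow> e \<in> idempotents R"
  and idempotents_carrier: "e \<in> idempotents R \<Longrightarrow> e \<in> carrier R"
  and idempotents_square: "e \<in> idempotents R \<Longrightarrow> e \<otimes> e = e"
  by (auto simp: idempotents_def)

lemma idempotents_compl:
  assumes "e \<in> idempotents R"
  shows "\<one> \<ominus> e \<in> idempotents R"
proof (rule idempotentsI)
  have c: "e \<in> carrier R" and i: "e \<otimes> e = e"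
    using assms by (auto simp: idempotents_def)
  show "\<one> \<ominus> e \<in> carrier R" using c by simp
  have "(\<one> \<ominus> e) \<otimes> (\<one> \<ominus> e) = \<one> \<ominus> e \<ominus> e \<oplus> e \<otimes> e" using c by algebra
  also have "\<dots> = \<one> \<ominus> e" unfolding i using c by algebra
  finally show "(\<one> \<ominus> e) \<otimes> (\<one> \<ominus> e) = \<one> \<ominus> e" .
qed

lemma idempotents_mult_compl:
  assumes "e \<in> idempotents R"
  shows "e \<otimes> (\<one> \<ominus> e) = \<zero>" "(\<one> \<ominus> e) \<otimes> e = \<zero>"
proof -
  have c: "e \<in> carrier R" and i: "e \<otimes> e = e"
    using assms by (auto simp: idempotents_def)
  have "e \<otimes> (\<one> \<ominus> e) = e \<ominus> e \<otimes> e" using c by algebra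
  then show "e \<otimes> (\<one> \<ominus> e) = \<zero>" unfolding i using c by (simp add: a_minus_def r_neg)
  have "(\<one> \<ominus> e) \<otimes> e = e \<ominus> e \<otimes> e" using c by algebra
  then show "(\<one> \<ominus> e) \<otimes> e = \<zero>" unfolding i using c by (simp add: a_minus_def r_neg)
qed

text \<open>The element is 2e - 1, which equals 1 on eR and -1 on (1-e)R and is therefore its own
  inverse. It is the unit that accompanies 1 - e in a clean decomposition of e.\<close>

lemma idempotent_symmetry:
  assumes "e \<in> idempotents R"
  shows "(e \<ominus> (\<one> \<ominus> e)) \<otimes> (e \<ominus> (\<one> \<ominus> e)) = \<one>" "e \<ominus> (\<one> \<ominus> e) \<in> Units R"
proof -
  have c: "e \<in> carrier R" and i: "e \<otimes> e = e"
    using assms by (auto simp: idempotents_def)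
  have "(e \<ominus> (\<one> \<ominus> e)) \<otimes> (e \<ominus> (\<one> \<ominus> e))
      = \<one> \<ominus> e \<ominus> e \<ominus> e \<ominus> e \<oplus> (e \<otimes> e \<oplus> e \<otimes> e \<oplus> e \<otimes> e \<oplus> e \<otimes> e)"
    using c by algebra
  also have "\<dots> = \<one>" unfolding i using c by algebra
  finally show w: "(e \<ominus> (\<one> \<ominus> e)) \<otimes> (e \<ominus> (\<one> \<ominus> e)) = \<one>" .
  have "e \<ominus> (\<one> \<ominus> e) \<in> carrier R" using c by simp
  then show "e \<ominus> (\<one> \<ominus> e) \<in> Units R" using w by (intro Units_of_two_sided)
qed

text \<open>Moving e by an element n of eR(1-e) gives another idempotent, because en = n, ne = 0 and
  nn = 0. Both proofs that idempotents are central play e off against e + n.\<close>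

lemma peirce_corner:
  assumes "e \<in> idempotents R" "r \<in> carrier R"
  defines "n \<equiv> e \<otimes> r \<otimes> (\<one> \<ominus> e)"
  shows "n \<in> carrier R" "e \<otimes> n = n" "n \<otimes> e = \<zero>" "n \<otimes> n = \<zero>" "e \<oplus> n \<in> idempotents R"
proof -
  have c: "e \<in> carrier R" and i: "e \<otimes> e = e"
    using assms by (auto simp: idempotents_def)
  note z = idempotents_mult_compl[OF assms(1)]
  show n: "n \<in> carrier R" using c assms by simp
  show en: "e \<otimes> n = n" unfolding n_def using c assms(2) i
    by (metis m_assoc m_closed minus_closed one_closed)
  show ne: "n \<otimes> e = \<zero>" unfolding n_def using c assms(2) z
    by (simp add: m_assoc)
  show nn: "n \<otimes> n = \<zero>"
    using en ne n c by (metis m_assoc l_null)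
  have "(e \<oplus> n) \<otimes> (e \<oplus> n) = e \<otimes> e \<oplus> e \<otimes> n \<oplus> (n \<otimes> e \<oplus> n \<otimes> n)"
    using c n by algebra
  also have "\<dots> = e \<oplus> n" unfolding i en ne nn using c n by simp
  finally show "e \<oplus> n \<in> idempotents R"
    using c n by (intro idempotentsI) auto
qed

text \<open>The commutator er - re is the difference of er(1-e) and (1-e)re. The second term
  vanishes by the corner hypothesis applied to the idempotent 1 - e.\<close>

lemma idempotents_central:
  assumes corner: "\<And>e r. e \<in> idempotents R \<Longrightarrow> r \<in> carrier R \<Longrightarrow> e \<otimes> r \<otimes> (\<one> \<ominus> e) = \<zero>"
    and "e \<in> idempotents R" "r \<in> carrier R"
  shows "e \<otimes> r = r \<otimes> e"
proof -
  have c: "e \<in> carrier R" using assms(2) by (rule idempotents_carrier)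
  have "\<one> \<ominus> (\<one> \<ominus> e) = e" using c by algebra
  then have "(\<one> \<ominus> e) \<otimes> r \<otimes> e = \<zero>"
    using corner[OF idempotents_compl[OF assms(2)] assms(3)] by simp
  moreover have "e \<otimes> r \<ominus> r \<otimes> e = e \<otimes> r \<otimes> (\<one> \<ominus> e) \<ominus> (\<one> \<ominus> e) \<otimes> r \<otimes> e"
    using c assms(3) by algebra
  ultimately have "e \<otimes> r \<ominus> r \<otimes> e = \<zero>"
    using corner[OF assms(2,3)] by (simp add: a_minus_def)
  then show ?thesis using c assms(3) by simp
qed

text \<open>An idempotent always has the clean decomposition \<open>e = (\<one> \<ominus> e) \<oplus> w\<close> with
  \<open>w = e \<ominus> (\<one> \<ominus> e)\<close>; an element \<open>n\<close> of the Peirce corner gives a second one,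
  \<open>e = (\<one> \<ominus> (e \<oplus> n)) \<oplus> (w \<oplus> n)\<close>.\<close>

lemma idempotents_central_of_uniquely_clean:
  assumes "\<And>e. e \<in> idempotents R \<Longrightarrow> uniquely_clean R e"
    and "e \<in> idempotents R" "r \<in> carrier R"
  shows "e \<otimes> r = r \<otimes> e"
proof (rule idempotents_central[OF _ assms(2,3)])
  fix e r assume e: "e \<in> idempotents R" and r: "r \<in> carrier R"
  have c: "e \<in> carrier R" and i: "e \<otimes> e = e"
    using e by (auto simp: idempotents_def)
  define n where "n = e \<otimes> r \<otimes> (\<one> \<ominus> e)"
  note n = peirce_corner[OF e r, folded n_def]
  define w where "w = e \<ominus> (\<one> \<ominus> e)"
  have w: "w \<in> carrier R" using c by (simp add: w_def)
  have ww: "w \<otimes> w = \<one>" unfolding w_def by (rule idempotent_symmetry(1)[OF e])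
  have "w \<otimes> n = e \<otimes> n \<oplus> e \<otimes> n \<ominus> n" unfolding w_def using c n(1) by algebra
  then have wn: "w \<otimes> n = n" unfolding n(2) using n(1) by algebra
  have "n \<otimes> w = n \<otimes> e \<oplus> n \<otimes> e \<ominus> n" unfolding w_def using c n(1) by algebra
  then have nw: "n \<otimes> w = \<ominus> n" unfolding n(3) using n(1) by algebra
  have "(w \<oplus> n) \<otimes> (w \<oplus> n) = w \<otimes> w \<oplus> w \<otimes> n \<oplus> n \<otimes> w \<oplus> n \<otimes> n"
    using w n(1) by algebra
  also have "\<dots> = \<one>" unfolding ww wn nw n(4) using n(1) by algebra
  finally have wnwn: "(w \<oplus> n) \<otimes> (w \<oplus> n) = \<one>" .
  have U: "w \<in> Units R" "w \<oplus> n \<in> Units R"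
    using Units_of_two_sided[OF w w w ww ww]
      Units_of_two_sided[OF a_closed[OF w n(1)] a_closed[OF w n(1)] a_closed[OF w n(1)] wnwn wnwn]
    by blast+
  have f: "\<one> \<ominus> (e \<oplus> n) \<in> idempotents R" "\<one> \<ominus> e \<in> idempotents R"
    using n(5) e by (auto intro: idempotents_compl)
  have "e = (\<one> \<ominus> e) \<oplus> w" "e = (\<one> \<ominus> (e \<oplus> n)) \<oplus> (w \<oplus> n)"
    unfolding w_def using c n(1) by algebra+
  then have "w = w \<oplus> n"
    using uniquely_cleanD(2)[OF assms(1)[OF e] f(2) U(1) _ f(1) U(2)] by blast
  moreover have "n = \<ominus> w \<oplus> (w \<oplus> n)" using w n(1) by algebra
  ultimately have "n = \<ominus> w \<oplus> w" by simp
  then show "n = \<zero>" using w by algebra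
qed

section \<open>Units through powers and factors; local rings\<close>

lemma Units_of_pow:
  assumes "x \<in> carrier R" "x [^] (n::nat) \<in> Units R" "n \<ge> 1"
  shows "x \<in> Units R"
proof -
  obtain k where k: "n = Suc k" using assms(3) by (cases n) auto
  let ?p = "x [^] n"
  have c: "inv ?p \<in> carrier R" "?p \<in> carrier R" using assms by auto
  have 1: "x \<otimes> (x [^] k \<otimes> inv ?p) = \<one>"
    using assms(1,2) c Units_r_inv[OF assms(2)] unfolding k
    by (metis m_assoc nat_pow_Suc2 nat_pow_closed)
  have 2: "(inv ?p \<otimes> x [^] k) \<otimes> x = \<one>"
    using assms(1,2) c Units_l_inv[OF assms(2)] unfolding k
    by (metis m_assoc nat_pow_Suc nat_pow_closed)
  have "inv ?p \<otimes> x [^] k = x [^] k \<otimes> inv ?p"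
    using inv_unique[OF 2 1] assms(1) c by auto
  then show ?thesis using 1 2 assms(1) c by (auto simp: Units_def intro!: bexI[of _ "x [^] k \<otimes> inv ?p"])
qed

text \<open>The factor is the geometric sum 1 + x + ... + x^(n-1), the same on both sides. Having it
  on both sides lets 1 - x inherit invertibility from 1 - x^n without commutativity.\<close>

lemma one_minus_pow_factor:
  assumes "x \<in> carrier R"
  shows "\<exists>s \<in> carrier R. \<one> \<ominus> x [^] (n::nat) = (\<one> \<ominus> x) \<otimes> s \<and> \<one> \<ominus> x [^] n = s \<otimes> (\<one> \<ominus> x)"
proof (induction n)
  case 0
  show ?case using assms by (intro bexI[of _ \<zero>]) (auto simp: r_neg a_minus_def)
next
  case (Suc n)
  then obtain s where s: "s \<in> carrier R" "\<one> \<ominus> x [^] n = (\<one> \<ominus> x) \<otimes> s" "\<one> \<ominus> x [^] n = s \<otimes> (\<one> \<ominus> x)"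
    by blast
  have p: "x [^] n \<in> carrier R" using assms by simp
  have "\<one> \<ominus> x [^] Suc n = (\<one> \<ominus> x [^] n) \<oplus> x [^] n \<otimes> (\<one> \<ominus> x)"
    unfolding nat_pow_Suc using assms p by algebra
  also have "\<dots> = (s \<oplus> x [^] n) \<otimes> (\<one> \<ominus> x)" unfolding s(3) using assms s(1) p by algebra
  finally have 1: "\<one> \<ominus> x [^] Suc n = (s \<oplus> x [^] n) \<otimes> (\<one> \<ominus> x)" .
  have "\<one> \<ominus> x [^] Suc n = (\<one> \<ominus> x [^] n) \<oplus> (\<one> \<ominus> x) \<otimes> x [^] n"
    unfolding nat_pow_Suc2[OF assms] using assms p by algebra
  also have "\<dots> = (\<one> \<ominus> x) \<otimes> (s \<oplus> x [^] n)" unfolding s(2) using assms s(1) p by algebra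
  finally show ?case using 1 s(1) p by (intro bexI[of _ "s \<oplus> x [^] n"]) auto
qed

lemma Units_of_mult:
  assumes "x \<in> carrier R" "s \<in> carrier R" "x \<otimes> s \<in> Units R" "s \<otimes> x \<in> Units R"
  shows "x \<in> Units R"
proof (rule Units_of_two_sided)
  show "x \<otimes> (s \<otimes> inv (x \<otimes> s)) = \<one>"
    using assms by (simp add: m_assoc[symmetric])
  show "inv (s \<otimes> x) \<otimes> s \<otimes> x = \<one>"
    using assms by (simp add: m_assoc)
qed (use assms in auto)

lemma idealI_closed:
  assumes sub: "I \<subseteq> carrier R" and zero: "\<zero> \<in> I"
    and add: "\<And>a b. a \<in> I \<Longrightarrow> b \<in> I \<Longrightarrow> a \<oplus> b \<in> I"
    and l: "\<And>a x. a \<in> I \<Longrightarrow> x \<in> carrier R \<Longrightarrow> x \<otimes> a \<in> I"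
    and r: "\<And>a x. a \<in> I \<Longrightarrow> x \<in> carrier R \<Longrightarrow> a \<otimes> x \<in> I"
  shows "ideal I R"
proof (rule idealI[OF ring_axioms _ l r])
  show "subgroup I (add_monoid R)"
  proof (rule add.subgroupI)
    fix a assume a: "a \<in> I"
    then have "\<ominus> \<one> \<otimes> a \<in> I" using l by simp
    then show "\<ominus> a \<in> I" using a sub by (auto simp: l_minus)
  qed (use assms in auto)
qed

text \<open>The product yx is idempotent, and the local hypothesis leaves only 0 and 1 as
  idempotents. The value 0 would give 1 = (xy)(xy) = x(yx)y = 0.\<close>

lemma right_inverse_imp_Units_of_local:
  assumes loc: "\<And>x. x \<in> carrier R \<Longrightarrow> x \<in> Units R \<or> \<one> \<ominus> x \<in> Units R"
    and nontrivial: "\<one> \<noteq> \<zero>"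
    and x: "x \<in> carrier R" and y: "y \<in> carrier R" and xy: "x \<otimes> y = \<one>"
  shows "x \<in> Units R \<and> y \<in> Units R"
proof -
  let ?p = "y \<otimes> x"
  have p: "?p \<in> carrier R" using x y by simp
  have "?p \<otimes> ?p = y \<otimes> (x \<otimes> y) \<otimes> x" using x y by algebra
  then have "?p \<otimes> ?p = ?p" using x y xy by simp
  then have idem: "?p \<in> idempotents R" using p by (intro idempotentsI)
  have "?p = \<one>" using loc[OF p]
  proof
    assume u: "?p \<in> Units R"
    then show ?thesis using \<open>?p \<otimes> ?p = ?p\<close> p
      by (metis Units_l_cancel r_one one_closed)
  next
    assume u: "\<one> \<ominus> ?p \<in> Units R"
    have "?p = \<zero>"
      using u idempotents_mult_compl(2)[OF idem] p
      by (metis Units_closed Units_l_cancel r_null zero_closed)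
    then have "x \<otimes> (y \<otimes> x) \<otimes> y = \<zero>" using x y by simp
    moreover have "x \<otimes> (y \<otimes> x) \<otimes> y = (x \<otimes> y) \<otimes> (x \<otimes> y)" using x y by algebra
    ultimately show ?thesis using nontrivial xy by simp
  qed
  then show ?thesis using Units_of_two_sided x y xy by metis
qed

text \<open>Absorption holds because one-sided inverses are two-sided here. For sums, if a + b had
  inverse w, then aw and bw = 1 - aw could not both be non-units.\<close>

lemma ideal_nonunits_of_local:
  assumes loc: "\<And>x. x \<in> carrier R \<Longrightarrow> x \<in> Units R \<or> \<one> \<ominus> x \<in> Units R"
    and nontrivial: "\<one> \<noteq> \<zero>"
  shows "ideal (carrier R - Units R) R"
proof (rule idealI_closed)
  note inv1 = right_inverse_imp_Units_of_local[OF loc nontrivial]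
  have "\<zero> \<notin> Units R"
    using nontrivial by (metis Units_closed Units_r_inv_ex l_null)
  then show "\<zero> \<in> carrier R - Units R" by simp
  show l: "x \<otimes> a \<in> carrier R - Units R" if "a \<in> carrier R - Units R" "x \<in> carrier R" for a x
  proof -
    have False if u: "x \<otimes> a \<in> Units R"
    proof -
      have "(inv (x \<otimes> a) \<otimes> x) \<otimes> a = \<one>"
        using u that \<open>a \<in> _\<close> \<open>x \<in> _\<close> by (simp add: m_assoc)
      then show False using inv1[of "inv (x \<otimes> a) \<otimes> x" a] u \<open>a \<in> _\<close> \<open>x \<in> _\<close> by auto
    qed
    then show ?thesis using that by auto
  qed
  show r: "a \<otimes> x \<in> carrier R - Units R" if "a \<in> carrier R - Units R" "x \<in> carrier R" for a x
  proof -
    have False if u: "a \<otimes> x \<in> Units R"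
    proof -
      have "a \<otimes> (x \<otimes> inv (a \<otimes> x)) = \<one>"
        using u that \<open>a \<in> _\<close> \<open>x \<in> _\<close> by (simp add: m_assoc[symmetric])
      then show False using inv1[of a "x \<otimes> inv (a \<otimes> x)"] u \<open>a \<in> _\<close> \<open>x \<in> _\<close> by auto
    qed
    then show ?thesis using that by auto
  qed
  fix a b assume ab: "a \<in> carrier R - Units R" "b \<in> carrier R - Units R"
  have False if u: "a \<oplus> b \<in> Units R"
  proof -
    let ?w = "inv (a \<oplus> b)"
    have c: "a \<in> carrier R" "b \<in> carrier R" "?w \<in> carrier R" using ab u by auto
    have "a \<otimes> ?w \<oplus> b \<otimes> ?w = \<one>" using u c by (simp add: l_distr[symmetric])
    moreover have "b \<otimes> ?w = (a \<otimes> ?w \<oplus> b \<otimes> ?w) \<ominus> a \<otimes> ?w" using c by algebra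
    ultimately have "b \<otimes> ?w = \<one> \<ominus> a \<otimes> ?w" by simp
    then show False using loc[of "a \<otimes> ?w"] r[OF ab(1) c(3)] r[OF ab(2) c(3)] by auto
  qed
  then show "a \<oplus> b \<in> carrier R - Units R" using ab by auto
qed auto

section \<open>Principal right ideals, quotient rings and homomorphisms\<close>

lemma principal_right_idealI: "r \<in> carrier R \<Longrightarrow> y = x \<otimes> r \<Longrightarrow> y \<in> x <# carrier R"
  and principal_right_idealE:
    "y \<in> x <# carrier R \<Longrightarrow> (\<And>r. r \<in> carrier R \<Longrightarrow> y = x \<otimes> r \<Longrightarrow> P) \<Longrightarrow> P"
  unfolding l_coset_def by blast+

lemma quot_zero_iff:
  assumes "ideal I R" "x \<in> carrier R"
  shows "I +> x = \<zero>\<^bsub>R Quot I\<^esub> \<longleftrightarrow> x \<in> I"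
  using a_rcos_zero[OF assms(1)] ideal.rcos_const_imp_mem[OF assms]
  by (auto simp: FactRing_def)

lemma quot_carrierE:
  assumes "A \<in> carrier (R Quot I)"
  obtains x where "x \<in> carrier R" "A = I +> x"
  using assms by (auto simp: FactRing_simps)

end

lemma (in ring_hom_ring) hom_Units:
  assumes "u \<in> Units R"
  shows "h u \<in> Units S"
proof (rule S.Units_of_two_sided)
  show "h u \<otimes>\<^bsub>S\<^esub> h (inv u) = \<one>\<^bsub>S\<^esub>" "h (inv u) \<otimes>\<^bsub>S\<^esub> h u = \<one>\<^bsub>S\<^esub>"
    using assms by (metis R.Units_closed R.Units_inv_closed R.Units_r_inv R.Units_l_inv hom_mult hom_one)+
qed (use assms in auto)

lemma (in ring_hom_ring) hom_nat_pow:
  "x \<in> carrier R \<Longrightarrow> h (x [^] (n::nat)) = h x [^]\<^bsub>S\<^esub> n"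
  by (induction n) auto

lemma (in ring_hom_ring) hom_minus:
  "x \<in> carrier R \<Longrightarrow> y \<in> carrier R \<Longrightarrow> h (x \<ominus> y) = h x \<ominus>\<^bsub>S\<^esub> h y"
  by (simp add: a_minus_def R.minus_eq S.minus_eq)

lemma (in ring_hom_ring) ideal_vimage:
  assumes "ideal J S"
  shows "ideal {x \<in> carrier R. h x \<in> J} R"
proof -
  interpret J: ideal J S by fact
  show ?thesis
    by (rule R.idealI_closed) (auto intro: J.I_l_closed J.I_r_closed)
qed

text \<open>The non-units of the local quotient form an ideal whose preimage in R contains I but not
  1. Maximality makes this preimage equal to I, so the quotient is a division ring.\<close>

lemma (in maximalideal) quot_Units_iff_of_local:
  assumes loc: "\<And>x. x \<in> carrier R \<Longrightarrow> I +> x \<in> Units (R Quot I) \<or> I +> (\<one> \<ominus> x) \<in> Units (R Quot I)"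
    and x: "x \<in> carrier R"
  shows "I +> x \<in> Units (R Quot I) \<longleftrightarrow> x \<notin> I"
proof -
  interpret Q: ring_hom_ring R "R Quot I" "(+>) I" by (rule rcos_ring_hom_ring)
  note zero = quot_zero_iff[OF ideal_axioms]
  have "\<one> \<notin> I" using I_notcarr one_imp_carrier by auto
  then have nontrivial: "\<one>\<^bsub>R Quot I\<^esub> \<noteq> \<zero>\<^bsub>R Quot I\<^esub>"
    using zero[of \<one>] Q.hom_one by simp
  have loc': "A \<in> Units (R Quot I) \<or> \<one>\<^bsub>R Quot I\<^esub> \<ominus>\<^bsub>R Quot I\<^esub> A \<in> Units (R Quot I)"
    if "A \<in> carrier (R Quot I)" for A
    using quot_carrierE[OF that] loc Q.hom_minus[of \<one>] by (metis Q.hom_one one_closed)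
  let ?N = "carrier (R Quot I) - Units (R Quot I)"
  let ?J = "{x \<in> carrier R. I +> x \<in> ?N}"
  have N: "ideal ?N (R Quot I)"
    by (rule Q.S.ideal_nonunits_of_local[OF loc' nontrivial])
  have J: "ideal ?J R" by (rule Q.ideal_vimage[OF N])
  have "I \<subseteq> ?J"
  proof
    fix y assume y: "y \<in> I"
    then have "I +> y = \<zero>\<^bsub>R Quot I\<^esub>" using zero[of y] Icarr by auto
    then show "y \<in> ?J" using y Icarr
      additive_subgroup.zero_closed[OF ideal.axioms(1)[OF N]] by auto
  qed
  moreover have "\<one> \<notin> ?J" using Q.hom_one Q.S.Units_one_closed by auto
  ultimately have "?J = I" using I_maximal[OF J] by blast
  then show ?thesis using x Q.hom_closed[OF x] by blast
qed

section \<open>Rings with central idempotents\<close>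

text \<open>Both implications first establish this centrality, one from unique cleanness and the
  other from unique lifting, and then continue inside this locale.\<close>

locale idem_central_ring = ring +
  assumes idem_comm: "e \<in> idempotents R \<Longrightarrow> r \<in> carrier R \<Longrightarrow> e \<otimes> r = r \<otimes> e"
begin

lemma idempotents_mult:
  assumes "e \<in> idempotents R" "f \<in> idempotents R"
  shows "e \<otimes> f \<in> idempotents R"
proof (rule idempotentsI)
  have c: "e \<in> carrier R" "f \<in> carrier R" using assms by (auto simp: idempotents_def)
  then show "e \<otimes> f \<in> carrier R" by simp
  have "e \<otimes> f \<otimes> (e \<otimes> f) = e \<otimes> (f \<otimes> e) \<otimes> f" using c by algebra
  also have "\<dots> = (e \<otimes> e) \<otimes> (f \<otimes> f)" unfolding idem_comm[OF assms(2) c(1)] using c by algebra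
  finally show "e \<otimes> f \<otimes> (e \<otimes> f) = e \<otimes> f"
    using assms by (simp add: idempotents_square)
qed

text \<open>The idempotent p = yx is central, so p = p(xy) = xpy = (xy)(xy) = 1.\<close>

lemma right_inverse_imp_Units:
  assumes "x \<in> carrier R" "y \<in> carrier R" "x \<otimes> y = \<one>"
  shows "x \<in> Units R"
proof -
  let ?p = "y \<otimes> x"
  have "?p \<otimes> ?p = y \<otimes> (x \<otimes> y) \<otimes> x" using assms(1,2) by algebra
  then have "?p \<in> idempotents R" using assms by (intro idempotentsI) auto
  then have "?p \<otimes> y = y \<otimes> ?p" "x \<otimes> ?p = ?p \<otimes> x"
    using assms idem_comm[of ?p] by auto
  moreover have "?p = ?p \<otimes> (x \<otimes> y)" "?p \<otimes> (x \<otimes> y) = (?p \<otimes> x) \<otimes> y"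
    using assms by (simp_all add: m_assoc)
  moreover have "x \<otimes> ?p \<otimes> y = (x \<otimes> y) \<otimes> (x \<otimes> y)" using assms(1,2) by algebra
  ultimately have "?p = \<one>" using assms(3) by simp
  then show ?thesis using Units_of_two_sided assms by metis
qed

text \<open>Multiplying x = e + u by 1 - e leaves u(1-e), and multiplying 1 - x by e leaves -ue;
  cancelling u gives both memberships. The exchange idempotent for x is thus 1 - e, not e.\<close>

lemma clean_imp_exchange:
  assumes "e \<in> idempotents R" "u \<in> Units R" "x = e \<oplus> u"
  shows "\<one> \<ominus> e \<in> x <# carrier R" "e \<in> (\<one> \<ominus> x) <# carrier R"
proof -
  have c: "e \<in> carrier R" "u \<in> carrier R" "inv u \<in> carrier R" and i: "e \<otimes> e = e"
    using assms by (auto simp: idempotents_def)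
  have ui: "u \<otimes> inv u = \<one>" using assms by simp
  have eu: "u \<otimes> e = e \<otimes> u" using idem_comm[OF assms(1) c(2)] by simp
  have "x \<otimes> ((\<one> \<ominus> e) \<otimes> inv u) = (e \<ominus> e \<otimes> e \<oplus> u \<ominus> u \<otimes> e) \<otimes> inv u"
    unfolding assms(3) using c by algebra
  also have "\<dots> = (\<one> \<ominus> e) \<otimes> (u \<otimes> inv u)" unfolding i eu using c by algebra
  finally have "\<one> \<ominus> e = x \<otimes> ((\<one> \<ominus> e) \<otimes> inv u)" using ui c by simp
  then show "\<one> \<ominus> e \<in> x <# carrier R"
    by (rule principal_right_idealI[rotated]) (use c in auto)
  have "(\<one> \<ominus> x) \<otimes> (e \<otimes> \<ominus> (inv u)) = (e \<otimes> e \<ominus> e \<oplus> u \<otimes> e) \<otimes> inv u"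
    unfolding assms(3) using c by algebra
  also have "\<dots> = e \<otimes> (u \<otimes> inv u)" unfolding i eu using c by algebra
  finally have "e = (\<one> \<ominus> x) \<otimes> (e \<otimes> \<ominus> (inv u))" using ui c by simp
  then show "e \<in> (\<one> \<ominus> x) <# carrier R"
    by (rule principal_right_idealI[rotated]) (use c in auto)
qed

text \<open>Since e is central, the elements x with xe in M form a two-sided ideal containing M and
  1 - e. By maximality it is M, or it contains 1.\<close>

lemma maximalideal_idempotent:
  assumes M: "maximalideal M R" and e: "e \<in> idempotents R"
  shows "e \<in> M \<or> \<one> \<ominus> e \<in> M"
proof -
  interpret M: maximalideal M R by fact
  have c: "e \<in> carrier R" using e by (rule idempotents_carrier)
  let ?J = "{x \<in> carrier R. x \<otimes> e \<in> M}"
  have "ideal ?J R"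
  proof (rule idealI_closed)
    fix a x assume a: "a \<in> ?J" and x: "x \<in> carrier R"
    then have "a \<otimes> e \<otimes> x \<in> M" "x \<otimes> (a \<otimes> e) \<in> M" using M.I_r_closed M.I_l_closed by auto
    moreover have "a \<otimes> e \<otimes> x = a \<otimes> x \<otimes> e" "x \<otimes> (a \<otimes> e) = x \<otimes> a \<otimes> e"
      using a x c idem_comm[OF e x] by (simp_all add: m_assoc)
    ultimately show "x \<otimes> a \<in> ?J" "a \<otimes> x \<in> ?J" using a x by auto
  qed (use c in \<open>auto simp: l_distr\<close>)
  moreover have "M \<subseteq> ?J" using c M.Icarr M.I_r_closed by auto
  ultimately have "?J = M \<or> ?J = carrier R" using M.I_maximal[of ?J] by auto
  then show ?thesis
  proof
    assume "?J = M"
    moreover have "\<one> \<ominus> e \<in> ?J"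
      using c idempotents_mult_compl(2)[OF e] M.zero_closed by simp
    ultimately show ?thesis by blast
  next
    assume "?J = carrier R"
    then have "\<one> \<otimes> e \<in> M" using one_closed by blast
    then show ?thesis using c by simp
  qed
qed

end

section \<open>Complements of clean elements, lifting of idempotents, maximal ideals\<close>

context ring
begin

lemma Units_a_inv: "u \<in> Units R \<Longrightarrow> \<ominus> u \<in> Units R"
  by (rule Units_of_two_sided[of _ "\<ominus> (inv u)" "\<ominus> (inv u)"]) (auto simp: l_minus r_minus Units_closed)

text \<open>Replacing (e, u) by (1 - e, -u) is a bijection between the clean decompositions of x and
  those of 1 - x.\<close>

lemma uniquely_clean_one_minus:
  assumes "uniquely_clean R x"
  shows "uniquely_clean R (\<one> \<ominus> x)"
proof -
  from assms obtain e u where e: "e \<in> idempotents R" "u \<in> Units R" "x = e \<oplus> u"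
    by (rule uniquely_cleanE)
  have c: "e \<in> carrier R" "u \<in> carrier R" using e by (auto simp: idempotents_def)
  show ?thesis
  proof (rule uniquely_cleanI)
    show "\<one> \<ominus> x = (\<one> \<ominus> e) \<oplus> \<ominus> u" unfolding e(3) using c by algebra
    fix f v assume f: "f \<in> idempotents R" "v \<in> Units R" "\<one> \<ominus> x = f \<oplus> v"
    have c': "f \<in> carrier R" "v \<in> carrier R" "x \<in> carrier R"
      using f c e by (auto simp: idempotents_def)
    have "x = \<one> \<ominus> (\<one> \<ominus> x)" using c' by algebra
    also have "\<dots> = (\<one> \<ominus> f) \<oplus> \<ominus> v" unfolding f(3) using c' by algebra
    finally have "e = \<one> \<ominus> f" "u = \<ominus> v"
      using uniquely_cleanD[OF assms e idempotents_compl[OF f(1)] Units_a_inv[OF f(2)]] by auto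
    moreover have "f = \<one> \<ominus> (\<one> \<ominus> f)" "v = \<ominus> (\<ominus> v)" using c' by algebra+
    ultimately show "f = \<one> \<ominus> e \<and> v = \<ominus> u" by simp
  qed (use e in \<open>auto intro: idempotents_compl Units_a_inv\<close>)
qed

text \<open>Exchange gives f = xr and 1 - f = (1-x)s. Then x - f = x(1-f) - (1-x)f equals (x - xx)(s
  - r), which lies in I.\<close>

lemma exchange_idempotents_lift:
  assumes exch: "exchange_ring R" and "ideal I R" and x: "x \<in> carrier R"
    and d: "x \<ominus> x [^] (2::nat) \<in> I"
  shows "\<exists>f \<in> idempotents R. x \<ominus> f \<in> I"
proof -
  interpret I: ideal I R by fact
  from exch x obtain f where f: "f \<in> idempotents R" "f \<in> x <# carrier R"
      "\<one> \<ominus> f \<in> (\<one> \<ominus> x) <# carrier R"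
    unfolding exchange_ring_def by blast
  then obtain r s where r: "r \<in> carrier R" "f = x \<otimes> r" and s: "s \<in> carrier R" "\<one> \<ominus> f = (\<one> \<ominus> x) \<otimes> s"
    by (elim principal_right_idealE)
  have c: "f \<in> carrier R" using f(1) by (rule idempotents_carrier)
  have sq: "x [^] (2::nat) = x \<otimes> x" using x by (simp add: numeral_2_eq_2)
  have "x \<ominus> f = x \<otimes> (\<one> \<ominus> f) \<ominus> (\<one> \<ominus> x) \<otimes> f" using x c by algebra
  also have "\<dots> = x \<otimes> ((\<one> \<ominus> x) \<otimes> s) \<ominus> (\<one> \<ominus> x) \<otimes> (x \<otimes> r)" unfolding s(2) r(2)[symmetric] ..
  also have "\<dots> = (x \<ominus> x \<otimes> x) \<otimes> (s \<ominus> r)" using x r(1) s(1) by algebra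
  finally have "x \<ominus> f = (x \<ominus> x \<otimes> x) \<otimes> (s \<ominus> r)" .
  moreover have "(x \<ominus> x \<otimes> x) \<otimes> (s \<ominus> r) \<in> I"
    using d r(1) s(1) unfolding sq by (intro I.I_r_closed) auto
  ultimately have "x \<ominus> f \<in> I" by (simp only:)
  then show ?thesis using f(1) by (rule bexI)
qed

text \<open>Zorn's lemma on the ideals that contain I and miss 1.\<close>

lemma ideal_subset_maximalideal:
  assumes "ideal I R" "\<one> \<notin> I"
  shows "\<exists>M. maximalideal M R \<and> I \<subseteq> M"
proof -
  let ?A = "{J. ideal J R \<and> I \<subseteq> J \<and> \<one> \<notin> J}"
  have "\<exists>M\<in>?A. \<forall>J\<in>?A. M \<subseteq> J \<longrightarrow> J = M"
  proof (rule subset_Zorn_nonempty)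
    show "?A \<noteq> {}" using assms by auto
    fix C assume ne: "C \<noteq> {}" and C: "subset.chain ?A C"
    then have "subset.chain {J. ideal J R} C" "C \<subseteq> ?A"
      by (auto simp: subset_chain_def)
    then have "ideal (\<Union>C) R" using chain_Union_is_ideal[of C] ne by simp
    then show "\<Union>C \<in> ?A" using \<open>C \<subseteq> ?A\<close> ne by blast
  qed
  then obtain M where MA: "M \<in> ?A" and max: "\<forall>J\<in>?A. M \<subseteq> J \<longrightarrow> J = M" by (rule bexE)
  then have M: "ideal M R" "I \<subseteq> M" "\<one> \<notin> M" by simp_all
  have "maximalideal M R"
  proof (rule maximalidealI[OF M(1)])
    show "carrier R \<noteq> M" using M(3) by auto
    fix J assume J: "ideal J R" "M \<subseteq> J" "J \<subseteq> carrier R"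
    show "J = M \<or> J = carrier R"
    proof (cases "\<one> \<in> J")
      case True
      then show ?thesis using ideal.one_imp_carrier[OF J(1)] by simp
    next
      case False
      then have "J \<in> ?A" using J M(2) by simp
      then show ?thesis using max J(2) bspec by blast
    qed
  qed
  then show ?thesis using M(2) by blast
qed

lemma mem_Jstar_iff: "x \<in> Jstar R \<longleftrightarrow> x \<in> carrier R \<and> (\<forall>M. maximalideal M R \<longrightarrow> x \<in> M)"
  by (auto simp: Jstar_def)

lemma ideal_Jstar: "ideal (Jstar R) R"
proof -
  \<comment> \<open>Inserting \<open>carrier R\<close> keeps the family nonempty even for the
    trivial ring, so the result on intersections of ideals applies.\<close>
  have "Jstar R = \<Inter>(insert (carrier R) {M. maximalideal M R})" by (auto simp: Jstar_def)
  also have "ideal \<dots> R"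
    by (rule i_Intersect) (auto simp: oneideal maximalideal_def)
  finally show ?thesis .
qed

end

section \<open>Idempotents modulo \<open>Jstar R\<close> and clean elements modulo one maximal
  ideal\<close>

context idem_central_ring
begin

text \<open>If g is nonzero, its annihilator is a proper ideal, two-sided because g is central. A
  maximal ideal above it contains 1 - g and, by hypothesis, also g.\<close>

lemma idempotent_in_Jstar:
  assumes g: "g \<in> idempotents R" "g \<in> Jstar R"
  shows "g = \<zero>"
proof (rule ccontr)
  assume "g \<noteq> \<zero>"
  have c: "g \<in> carrier R" using g(1) by (rule idempotents_carrier)
  let ?I = "{x \<in> carrier R. x \<otimes> g = \<zero>}"
  have "ideal ?I R"
  proof (rule idealI_closed)
    fix a x assume a: "a \<in> ?I" and x: "x \<in> carrier R"
    have a': "a \<in> carrier R" "a \<otimes> g = \<zero>" using a by auto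
    have "x \<otimes> a \<otimes> g = \<zero>" using a' x c by (simp add: m_assoc)
    moreover have "a \<otimes> x \<otimes> g = a \<otimes> g \<otimes> x"
      using a'(1) x c idem_comm[OF g(1) x] by (metis m_assoc)
    ultimately have "x \<otimes> a \<otimes> g = \<zero>" "a \<otimes> x \<otimes> g = \<zero>" using a' x by auto
    then show "x \<otimes> a \<in> ?I" "a \<otimes> x \<in> ?I" using a x by auto
  qed (use c in \<open>auto simp: l_distr\<close>)
  moreover have "\<one> \<notin> ?I" using c \<open>g \<noteq> \<zero>\<close> by simp
  ultimately obtain M where M: "maximalideal M R" "?I \<subseteq> M"
    using ideal_subset_maximalideal by blast
  interpret M: maximalideal M R by fact
  have "\<one> \<ominus> g \<in> M" using M(2) c idempotents_mult_compl(2)[OF g(1)] by auto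
  moreover have "g \<in> M" using g(2) M(1) by (simp add: mem_Jstar_iff)
  moreover have "\<one> = (\<one> \<ominus> g) \<oplus> g" using c by algebra
  ultimately have "\<one> \<in> M" using M.a_closed by metis
  then show False using M.I_notcarr M.one_imp_carrier by auto
qed

text \<open>For congruent idempotents p and q, the product p(1-q) is an idempotent of
  \<open>Jstar R\<close>, hence zero, so p = pq. By symmetry f = fg = gf = g.\<close>

lemma idempotents_eq_mod_Jstar:
  assumes f: "f \<in> idempotents R" and g: "g \<in> idempotents R" and d: "f \<ominus> g \<in> Jstar R"
  shows "f = g"
proof -
  interpret J: ideal "Jstar R" R by (rule ideal_Jstar)
  have absorb: "p = p \<otimes> q"
    if p: "p \<in> idempotents R" and q: "q \<in> idempotents R" and d: "p \<ominus> q \<in> Jstar R" for p q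
  proof -
    have c: "p \<in> carrier R" "q \<in> carrier R" using p q by (auto simp: idempotents_def)
    have "(p \<ominus> q) \<otimes> (\<one> \<ominus> q) = p \<otimes> (\<one> \<ominus> q) \<ominus> q \<otimes> (\<one> \<ominus> q)" using c by algebra
    also have "\<dots> = p \<otimes> (\<one> \<ominus> q)" unfolding idempotents_mult_compl[OF q] using c by algebra
    finally have "p \<otimes> (\<one> \<ominus> q) \<in> Jstar R" using J.I_r_closed[OF d, of "\<one> \<ominus> q"] c by auto
    then have z: "p \<otimes> (\<one> \<ominus> q) = \<zero>"
      by (intro idempotent_in_Jstar idempotents_mult p idempotents_compl q)
    have "p = p \<otimes> (\<one> \<ominus> q) \<oplus> p \<otimes> q" using c by algebra
    then show ?thesis unfolding z using c by simp
  qed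
  have c: "f \<in> carrier R" "g \<in> carrier R" using f g by (auto simp: idempotents_def)
  have "g \<ominus> f = \<ominus> (f \<ominus> g)" using c by algebra
  then have "g \<ominus> f \<in> Jstar R" using J.a_inv_closed[OF d] by simp
  then have "g = g \<otimes> f" by (rule absorb[OF g f])
  moreover have "f = f \<otimes> g" by (rule absorb[OF f g d])
  moreover have "f \<otimes> g = g \<otimes> f" by (rule idem_comm[OF f c(2)])
  ultimately show ?thesis by simp
qed

text \<open>Modulo M the idempotent e is 0 or 1, so a^n is congruent to u or 1 - a^n to -u.
  Invertibility then descends to a as a root, or to 1 - a as a factor on both sides.\<close>

lemma quot_Units_of_pow_clean:
  assumes M: "maximalideal M R" and a: "a \<in> carrier R" and n: "(n::nat) \<ge> 1"
    and e: "e \<in> idempotents R" "u \<in> Units R" "a [^] n = e \<oplus> u"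
  shows "M +> a \<in> Units (R Quot M) \<or> M +> (\<one> \<ominus> a) \<in> Units (R Quot M)"
proof -
  interpret M: maximalideal M R by fact
  interpret Q: ring_hom_ring R "R Quot M" "(+>) M" by (rule M.rcos_ring_hom_ring)
  note eq = quotient_eq_iff_same_a_r_cos[OF M.ideal_axioms]
  have c: "e \<in> carrier R" "u \<in> carrier R" using e by (auto simp: idempotents_def)
  from maximalideal_idempotent[OF M e(1)] show ?thesis
  proof
    assume "e \<in> M"
    moreover have "a [^] n \<ominus> u = e" unfolding e(3) using c by algebra
    ultimately have "M +> a [^] n = M +> u" using eq[of "a [^] n" u] a c by simp
    then have "(M +> a) [^]\<^bsub>R Quot M\<^esub> n \<in> Units (R Quot M)"
      using Q.hom_Units[OF e(2)] Q.hom_nat_pow[OF a, of n] by simp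
    then show ?thesis using Q.S.Units_of_pow n a by auto
  next
    assume "\<one> \<ominus> e \<in> M"
    moreover have "(\<one> \<ominus> a [^] n) \<ominus> (\<ominus> u) = \<one> \<ominus> e" unfolding e(3) using c by algebra
    ultimately have "M +> (\<one> \<ominus> a [^] n) = M +> (\<ominus> u)" using eq[of "\<one> \<ominus> a [^] n" "\<ominus> u"] a c by simp
    then have un: "M +> (\<one> \<ominus> a [^] n) \<in> Units (R Quot M)"
      using Q.hom_Units[OF Units_a_inv[OF e(2)]] by simp
    obtain s where s: "s \<in> carrier R" "\<one> \<ominus> a [^] n = (\<one> \<ominus> a) \<otimes> s" "\<one> \<ominus> a [^] n = s \<otimes> (\<one> \<ominus> a)"
      using one_minus_pow_factor[OF a] by blast
    have "M +> (\<one> \<ominus> a) \<in> Units (R Quot M)"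
    proof (rule Q.S.Units_of_mult)
      show "(M +> (\<one> \<ominus> a)) \<otimes>\<^bsub>R Quot M\<^esub> (M +> s) \<in> Units (R Quot M)"
        using un Q.hom_mult[of "\<one> \<ominus> a" s] a s(1) unfolding s(2) by simp
      show "(M +> s) \<otimes>\<^bsub>R Quot M\<^esub> (M +> (\<one> \<ominus> a)) \<in> Units (R Quot M)"
        using un Q.hom_mult[of s "\<one> \<ominus> a"] a s(1) unfolding s(3) by simp
    qed (use a s(1) in auto)
    then show ?thesis ..
  qed
qed

text \<open>If \<open>x \<otimes> e\<close> were invertible modulo \<open>M\<close>, exchange would give a nonzero central idempotent \<open>g\<close>
  below \<open>e\<close> on whose corner \<open>x\<close> is a unit, and \<open>x = (e \<ominus> g) \<oplus> (u \<oplus> g)\<close> would be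
  a second clean decomposition.\<close>

lemma uniquely_clean_corner_in_maximalideal:
  assumes exch: "exchange_ring R" and M: "maximalideal M R"
    and division: "\<And>x. x \<in> carrier R \<Longrightarrow> x \<notin> M \<Longrightarrow> M +> x \<in> Units (R Quot M)"
    and uc: "uniquely_clean R x" and e: "e \<in> idempotents R" "u \<in> Units R" "x = e \<oplus> u"
  shows "x \<otimes> e \<in> M"
proof (rule ccontr)
  assume out: "x \<otimes> e \<notin> M"
  interpret M: maximalideal M R by fact
  interpret Q: ring_hom_ring R "R Quot M" "(+>) M" by (rule M.rcos_ring_hom_ring)
  have c: "e \<in> carrier R" "u \<in> carrier R" "inv u \<in> carrier R"
    using e by (auto simp: idempotents_def)
  then have x: "x \<in> carrier R" using e(3) by simp
  have "M +> (x \<otimes> e) \<in> Units (R Quot M)" by (rule division[OF m_closed[OF x c(1)] out])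
  then obtain B where "B \<in> carrier (R Quot M)"
      "(M +> (x \<otimes> e)) \<otimes>\<^bsub>R Quot M\<^esub> B = \<one>\<^bsub>R Quot M\<^esub>"
    using Q.S.Units_r_inv_ex by blast
  then obtain r where r: "r \<in> carrier R" "M +> (x \<otimes> e \<otimes> r) = M +> \<one>"
    using quot_carrierE[of B M] Q.hom_mult[of "x \<otimes> e"] Q.hom_one x c by (metis m_closed)
  \<comment> \<open>\<open>y\<close> is a multiple of xe that is 1 modulo M, so the exchange
    idempotent \<open>g\<close> taken below \<open>y\<close> is 1 modulo M as well.\<close>
  define y where "y = x \<otimes> e \<otimes> r"
  have y: "y \<in> carrier R" using x c r by (simp add: y_def)
  have yM: "\<one> \<ominus> y \<in> M"
    using quotient_eq_iff_same_a_r_cos[OF M.ideal_axioms, of \<one> y] r y by (simp add: y_def)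
  from exch y obtain g where g: "g \<in> idempotents R" "g \<in> y <# carrier R"
      "\<one> \<ominus> g \<in> (\<one> \<ominus> y) <# carrier R"
    unfolding exchange_ring_def by blast
  then obtain t t' where t: "t \<in> carrier R" "g = y \<otimes> t"
    and t': "t' \<in> carrier R" "\<one> \<ominus> g = (\<one> \<ominus> y) \<otimes> t'"
    by (elim principal_right_idealE)
  have gM: "\<one> \<ominus> g \<in> M" unfolding t'(2) using yM t'(1) by (rule M.I_r_closed)
  have gc: "g \<in> carrier R" using g(1) by (rule idempotents_carrier)
  \<comment> \<open>\<open>s\<close> satisfies xs = g and lies in eR; as e is central, this puts g
    below e.\<close>
  define s where "s = e \<otimes> r \<otimes> t"
  have s: "s \<in> carrier R" using c r t by (simp add: s_def)
  have xs: "x \<otimes> s = g" unfolding t(2) y_def s_def using x c r(1) t(1) by (simp add: m_assoc)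
  have "e \<otimes> (x \<otimes> s) = x \<otimes> (e \<otimes> s)" using idem_comm[OF e(1) x] x c s by (simp flip: m_assoc)
  also have "e \<otimes> s = s" unfolding s_def using c r t idempotents_square[OF e(1)]
    by (simp flip: m_assoc)
  finally have eg: "e \<otimes> g = g" by (simp add: xs)
  have ge: "g \<otimes> e = g" using eg idem_comm[OF g(1) c(1)] by simp
  have f: "e \<ominus> g \<in> idempotents R"
  proof -
    have "(\<one> \<ominus> g) \<otimes> e = e \<ominus> g \<otimes> e" using c gc by algebra
    then show ?thesis using idempotents_mult[OF idempotents_compl[OF g(1)] e(1)] ge by simp
  qed
  \<comment> \<open>The idempotent g moves from the idempotent part to the unit part. The new
    element acts as x on the g-component and as u on the complementary one.\<close>
  define v where "v = u \<oplus> g"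
  have v: "v \<in> carrier R" using c gc by (simp add: v_def)
  have vg: "v \<otimes> g = x \<otimes> g"
  proof -
    have "v \<otimes> g = u \<otimes> g \<oplus> g \<otimes> g" unfolding v_def using c gc by algebra
    also have "g \<otimes> g = e \<otimes> g" using eg idempotents_square[OF g(1)] by simp
    also have "u \<otimes> g \<oplus> e \<otimes> g = x \<otimes> g" unfolding e(3) using c gc by algebra
    finally show ?thesis .
  qed
  \<comment> \<open>A right inverse is glued from \<open>inv u\<close> on the component of 1 - g and
    \<open>s\<close> on the component of g.\<close>
  have "v \<otimes> (inv u \<otimes> (\<one> \<ominus> g) \<oplus> s \<otimes> g) = \<one>"
  proof -
    have 1: "inv u \<otimes> (\<one> \<ominus> g) = (\<one> \<ominus> g) \<otimes> inv u"
      using idem_comm[OF idempotents_compl[OF g(1)] c(3)] by simp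
    have "v \<otimes> (\<one> \<ominus> g) = u \<otimes> (\<one> \<ominus> g) \<oplus> g \<otimes> (\<one> \<ominus> g)"
      unfolding v_def using c gc by algebra
    then have 2: "v \<otimes> (\<one> \<ominus> g) = u \<otimes> (\<one> \<ominus> g)"
      unfolding idempotents_mult_compl[OF g(1)] using c gc by simp
    have "v \<otimes> (inv u \<otimes> (\<one> \<ominus> g)) = v \<otimes> (\<one> \<ominus> g) \<otimes> inv u"
      unfolding 1 using v c gc by (simp add: m_assoc)
    also have "\<dots> = u \<otimes> (inv u \<otimes> (\<one> \<ominus> g))" unfolding 1 2 using c gc by (simp add: m_assoc)
    also have "\<dots> = \<one> \<ominus> g" using c gc e(2) by (simp flip: m_assoc)
    finally have 3: "v \<otimes> (inv u \<otimes> (\<one> \<ominus> g)) = \<one> \<ominus> g" .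
    have sg: "s \<otimes> g = g \<otimes> s" using idem_comm[OF g(1) s] by simp
    have "v \<otimes> (s \<otimes> g) = v \<otimes> g \<otimes> s" unfolding sg using v gc s by (simp add: m_assoc)
    also have "\<dots> = x \<otimes> (s \<otimes> g)" unfolding vg sg using x gc s by (simp add: m_assoc)
    also have "\<dots> = g" using xs x gc s idempotents_square[OF g(1)] by (simp flip: m_assoc)
    finally have 4: "v \<otimes> (s \<otimes> g) = g" .
    have "v \<otimes> (inv u \<otimes> (\<one> \<ominus> g) \<oplus> s \<otimes> g) = (\<one> \<ominus> g) \<oplus> g"
      using 3 4 v c gc s by (simp add: r_distr)
    also have "\<dots> = \<one>" using gc by algebra
    finally show ?thesis .
  qed
  then have "v \<in> Units R" using v c gc s by (intro right_inverse_imp_Units) auto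
  moreover have "x = (e \<ominus> g) \<oplus> v" unfolding e(3) v_def using c gc by algebra
  \<comment> \<open>Uniqueness forces g to vanish, while 1 - g lies in the proper ideal M.\<close>
  ultimately have "e = e \<ominus> g" using uniquely_cleanD(1)[OF uc e f] by blast
  moreover have "\<one> = (e \<ominus> (e \<ominus> g)) \<oplus> (\<one> \<ominus> g)" using c gc by algebra
  moreover have "e \<ominus> e = \<zero>" using c by (simp add: a_minus_def r_neg)
  ultimately have "\<one> = \<one> \<ominus> g" using gc by simp
  then show False using gM M.I_notcarr M.one_imp_carrier by simp
qed

end

section \<open>Consequences of unique pi-cleanness\<close>

lemma (in ring) uniquely_pi_clean_imp_idem_central:
  assumes "uniquely_pi_clean_ring R"
  shows "idem_central_ring R"
proof (intro idem_central_ring.intro ring_axioms idem_central_ring_axioms.intro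
    idempotents_central_of_uniquely_clean)
  fix e assume e: "e \<in> idempotents R"
  then obtain n :: nat where n: "n \<ge> 1" "uniquely_clean R (e [^] n)"
    using assms idempotents_carrier unfolding uniquely_pi_clean_ring_def by blast
  have "e [^] Suc k = e" for k :: nat
    using e idempotents_carrier idempotents_square by (induction k) auto
  then have "e [^] n = e" using n(1) by (cases n) auto
  then show "uniquely_clean R e" using n(2) by simp
qed

context idem_central_ring
begin

text \<open>The exchange idempotent of a^n also serves a, because a^n is a right multiple of a and 1
  - a^n is one of 1 - a.\<close>

lemma uniquely_pi_clean_imp_exchange:
  assumes "uniquely_pi_clean_ring R"
  shows "exchange_ring R"
  unfolding exchange_ring_def
proof (intro conjI ballI ring_axioms)
  fix a assume a: "a \<in> carrier R"
  then obtain n :: nat where n: "n \<ge> 1" "uniquely_clean R (a [^] n)"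
    using assms unfolding uniquely_pi_clean_ring_def by blast
  then obtain e u where e: "e \<in> idempotents R" "u \<in> Units R" "a [^] n = e \<oplus> u"
    by (elim uniquely_cleanE)
  obtain r where r: "r \<in> carrier R" "\<one> \<ominus> e = a [^] n \<otimes> r"
    using clean_imp_exchange(1)[OF e] by (rule principal_right_idealE)
  obtain t where t: "t \<in> carrier R" "e = (\<one> \<ominus> a [^] n) \<otimes> t"
    using clean_imp_exchange(2)[OF e] by (rule principal_right_idealE)
  obtain k where k: "n = Suc k" using n(1) by (cases n) auto
  obtain s where s: "s \<in> carrier R" "\<one> \<ominus> a [^] n = (\<one> \<ominus> a) \<otimes> s"
    using one_minus_pow_factor[OF a] by blast
  have c: "e \<in> carrier R" using e(1) by (rule idempotents_carrier)
  show "\<exists>f\<in>idempotents R. f \<in> a <# carrier R \<and> \<one> \<ominus> f \<in> (\<one> \<ominus> a) <# carrier R"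
  proof (intro bexI[of _ "\<one> \<ominus> e"] conjI)
    have "\<one> \<ominus> e = a \<otimes> (a [^] k \<otimes> r)"
      unfolding r(2) k nat_pow_Suc2[OF a] using a r(1) by (simp add: m_assoc)
    then show "\<one> \<ominus> e \<in> a <# carrier R"
      by (rule principal_right_idealI[rotated]) (use a r in auto)
    have "\<one> \<ominus> (\<one> \<ominus> e) = e" using c by algebra
    also have "e = (\<one> \<ominus> a) \<otimes> (s \<otimes> t)"
      using t(2) unfolding s(2) using a s(1) t(1) by (simp add: m_assoc)
    finally show "\<one> \<ominus> (\<one> \<ominus> e) \<in> (\<one> \<ominus> a) <# carrier R"
      by (rule principal_right_idealI[rotated]) (use s t in auto)
  qed (rule idempotents_compl[OF e(1)])
qed

text \<open>With x = a^n, both xe and (1-x)(1-e) lie in M. If e is in M, then x is 1 modulo M;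
  otherwise 1 - e is in M and so is x, which forces a into M. The exponent comes from a alone and
  does not vary with M.\<close>

lemma uniquely_pi_clean_imp_potent_mod_maximalideal:
  assumes upc: "uniquely_pi_clean_ring R" and M: "maximalideal M R"
    and a: "a \<in> carrier R" and n: "(n::nat) \<ge> 1" and uc: "uniquely_clean R (a [^] n)"
  shows "a [^] Suc n \<ominus> a \<in> M"
proof -
  interpret M: maximalideal M R by fact
  interpret Q: ring_hom_ring R "R Quot M" "(+>) M" by (rule M.rcos_ring_hom_ring)
  have exch: "exchange_ring R" using upc by (rule uniquely_pi_clean_imp_exchange)
  have loc: "M +> x \<in> Units (R Quot M) \<or> M +> (\<one> \<ominus> x) \<in> Units (R Quot M)"
    if x: "x \<in> carrier R" for x
  proof -
    obtain m :: nat where m: "m \<ge> 1" "uniquely_clean R (x [^] m)"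
      using upc x unfolding uniquely_pi_clean_ring_def by blast
    then obtain f v where "f \<in> idempotents R" "v \<in> Units R" "x [^] m = f \<oplus> v"
      by (elim uniquely_cleanE)
    then show ?thesis by (rule quot_Units_of_pow_clean[OF M x m(1)])
  qed
  note units = M.quot_Units_iff_of_local[OF loc]
  have division: "M +> x \<in> Units (R Quot M)" if "x \<in> carrier R" "x \<notin> M" for x
    using units that by blast
  obtain e u where e: "e \<in> idempotents R" "u \<in> Units R" "a [^] n = e \<oplus> u"
    using uc by (rule uniquely_cleanE)
  have c: "e \<in> carrier R" "u \<in> carrier R" using e by (auto simp: idempotents_def)
  define x where "x = a [^] n"
  have x: "x \<in> carrier R" using a by (simp add: x_def)
  have 1: "x \<otimes> e \<in> M"
    using uniquely_clean_corner_in_maximalideal[OF exch M division uc e] by (simp add: x_def)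
  \<comment> \<open>The corner result is applied a second time, to 1 - x with its parts 1 - e and
    -u.\<close>
  have "\<one> \<ominus> x = (\<one> \<ominus> e) \<oplus> \<ominus> u" unfolding x_def e(3) using c by algebra
  then have 2: "(\<one> \<ominus> x) \<otimes> (\<one> \<ominus> e) \<in> M"
    using uniquely_clean_corner_in_maximalideal[OF exch M division
        uniquely_clean_one_minus[OF uc] idempotents_compl[OF e(1)] Units_a_inv[OF e(2)]]
    by (simp add: x_def)
  have suc: "a [^] Suc n = x \<otimes> a" by (simp add: x_def)
  from maximalideal_idempotent[OF M e(1)] show ?thesis
  proof
    assume "e \<in> M"
    then have "(x \<ominus> \<one>) \<otimes> e \<in> M" using x by (intro M.I_l_closed) auto
    then have "\<ominus> ((\<one> \<ominus> x) \<otimes> (\<one> \<ominus> e)) \<oplus> (x \<ominus> \<one>) \<otimes> e \<in> M" 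
      using 2 by (intro M.a_closed M.a_inv_closed)
    also have "\<ominus> ((\<one> \<ominus> x) \<otimes> (\<one> \<ominus> e)) \<oplus> (x \<ominus> \<one>) \<otimes> e = x \<ominus> \<one>" using x c by algebra
    finally have "(x \<ominus> \<one>) \<otimes> a \<in> M" using a by (rule M.I_r_closed)
    also have "(x \<ominus> \<one>) \<otimes> a = x \<otimes> a \<ominus> a" using x a by algebra
    finally show ?thesis unfolding suc .
  next
    assume "\<one> \<ominus> e \<in> M"
    then have "x \<otimes> (\<one> \<ominus> e) \<in> M" using x by (rule M.I_l_closed)
    then have "x \<otimes> e \<oplus> x \<otimes> (\<one> \<ominus> e) \<in> M" using 1 by (intro M.a_closed)
    also have "x \<otimes> e \<oplus> x \<otimes> (\<one> \<ominus> e) = x" using x c by algebra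
    finally have xM: "x \<in> M" .
    have "a \<in> M"
    proof (rule ccontr)
      assume "a \<notin> M"
      then have "M +> a \<in> Units (R Quot M)" using division a by blast
      then have "(M +> a) [^]\<^bsub>R Quot M\<^esub> k \<in> Units (R Quot M)" for k :: nat
        by (induction k) auto
      then have "M +> x \<in> Units (R Quot M)" using Q.hom_nat_pow[OF a] by (simp add: x_def)
      then show False using units x xM by blast
    qed
    then show ?thesis unfolding suc a_minus_def
      using x by (intro M.a_closed M.a_inv_closed M.I_l_closed)
  qed
qed

lemma uniquely_pi_clean_imp_potent_quot:
  assumes upc: "uniquely_pi_clean_ring R"
  shows "potent_ring (R Quot Jstar R)"
  unfolding potent_ring_def
proof (intro conjI ballI)
  interpret J: ideal "Jstar R" R by (rule ideal_Jstar)
  interpret Q: ring_hom_ring R "R Quot Jstar R" "(+>) (Jstar R)" by (rule J.rcos_ring_hom_ring)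
  show "ring (R Quot Jstar R)" by (rule J.quotient_is_ring)
  fix A assume "A \<in> carrier (R Quot Jstar R)"
  then obtain a where a: "a \<in> carrier R" "A = Jstar R +> a" by (rule quot_carrierE)
  obtain n :: nat where n: "n \<ge> 1" "uniquely_clean R (a [^] n)"
    using upc a(1) unfolding uniquely_pi_clean_ring_def by blast
  have "a [^] Suc n \<ominus> a \<in> Jstar R"
    using uniquely_pi_clean_imp_potent_mod_maximalideal[OF upc _ a(1) n] a(1)
    by (auto simp: mem_Jstar_iff)
  then have "Jstar R +> a [^] Suc n = Jstar R +> a"
    using quotient_eq_iff_same_a_r_cos[OF ideal_Jstar, of "a [^] Suc n" a] a(1) by simp
  then have "A [^]\<^bsub>R Quot Jstar R\<^esub> Suc n = A" unfolding a(2) using Q.hom_nat_pow[OF a(1)] by metis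
  then show "\<exists>n::nat. n \<ge> 2 \<and> A [^]\<^bsub>R Quot Jstar R\<^esub> n = A" using n(1) by (intro exI[of _ "Suc n"]) auto
qed

text \<open>Existence comes from exchange. Two lifts of the same element are congruent to each other
  modulo \<open>Jstar R\<close>, hence equal.\<close>

lemma exchange_imp_idempotents_lift_uniquely_mod_Jstar:
  assumes "exchange_ring R"
  shows "idempotents_lift_uniquely_mod R (Jstar R)"
  unfolding idempotents_lift_uniquely_mod_def
proof (intro ballI impI)
  interpret J: ideal "Jstar R" R by (rule ideal_Jstar)
  fix a assume a: "a \<in> carrier R" "a \<ominus> a [^] (2::nat) \<in> Jstar R"
  then obtain f where f: "f \<in> idempotents R" "a \<ominus> f \<in> Jstar R"
    using exchange_idempotents_lift[OF assms ideal_Jstar] by blast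
  show "\<exists>!f. f \<in> idempotents R \<and> a \<ominus> f \<in> Jstar R"
  proof (rule ex1I[of _ f])
    fix g assume g: "g \<in> idempotents R \<and> a \<ominus> g \<in> Jstar R"
    have c: "f \<in> carrier R" "g \<in> carrier R" using f g by (auto simp: idempotents_def)
    have "(a \<ominus> f) \<oplus> \<ominus> (a \<ominus> g) \<in> Jstar R" using f g by (intro J.a_closed J.a_inv_closed) auto
    also have "(a \<ominus> f) \<oplus> \<ominus> (a \<ominus> g) = g \<ominus> f" using a(1) c by algebra
    finally show "g = f" using f g by (intro idempotents_eq_mod_Jstar) auto
  qed (use f in auto)
qed

end

section \<open>From exchange, potency and unique lifting to unique pi-cleanness\<close>

lemma (in ring) potent_square_zero:
  assumes "potent_ring R" "x \<in> carrier R" "x \<otimes> x = \<zero>"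
  shows "x = \<zero>"
proof -
  obtain n :: nat where n: "n \<ge> 2" "x [^] n = x"
    using assms unfolding potent_ring_def by blast
  then obtain k where "n = Suc (Suc k)" by (metis One_nat_def Suc_1 Suc_le_D Suc_le_mono)
  then have "x = x [^] k \<otimes> x \<otimes> x" using n(2) by simp
  also have "\<dots> = x [^] k \<otimes> (x \<otimes> x)" using assms(2) by (simp add: m_assoc)
  finally show ?thesis using assms by simp
qed

text \<open>Both e and f are lifts of the element e itself.\<close>

lemma (in ring) lift_uniquely_mod_eq:
  assumes "idempotents_lift_uniquely_mod R I" "ideal I R"
    and e: "e \<in> idempotents R" and f: "f \<in> idempotents R" and d: "e \<ominus> f \<in> I"
  shows "e = f"
proof -
  interpret I: ideal I R by fact
  have c: "e \<in> carrier R" using e by (rule idempotents_carrier)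
  have "e \<ominus> e = \<zero>" using c by (simp add: a_minus_def r_neg)
  moreover have "e [^] (2::nat) = e" using c idempotents_square[OF e] by (simp add: numeral_2_eq_2)
  ultimately have "e \<ominus> e \<in> I" "e \<ominus> e [^] (2::nat) \<in> I" by simp_all
  then show ?thesis
    using assms(1) c e f d unfolding idempotents_lift_uniquely_mod_def by blast
qed

text \<open>A corner element n squares to zero, so it vanishes in the potent quotient. Then e and e
  + n are congruent idempotents, and unique lifting gives n = 0.\<close>

lemma (in ring) potent_lift_imp_idem_central:
  assumes I: "ideal I R" and potent: "potent_ring (R Quot I)"
    and lift: "idempotents_lift_uniquely_mod R I"
  shows "idem_central_ring R"
proof (intro idem_central_ring.intro ring_axioms idem_central_ring_axioms.intro idempotents_central)
  interpret I: ideal I R by fact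
  interpret Q: ring_hom_ring R "R Quot I" "(+>) I" by (rule I.rcos_ring_hom_ring)
  fix e r assume e: "e \<in> idempotents R" and r: "r \<in> carrier R"
  have c: "e \<in> carrier R" using e by (rule idempotents_carrier)
  define n where "n = e \<otimes> r \<otimes> (\<one> \<ominus> e)"
  note n = peirce_corner[OF e r, folded n_def]
  have "(I +> n) \<otimes>\<^bsub>R Quot I\<^esub> (I +> n) = \<zero>\<^bsub>R Quot I\<^esub>"
    using Q.hom_mult[OF n(1) n(1)] n(4) Q.hom_zero by simp
  then have "I +> n = \<zero>\<^bsub>R Quot I\<^esub>" by (rule Q.S.potent_square_zero[OF potent Q.hom_closed[OF n(1)]])
  then have "\<ominus> n \<in> I" using quot_zero_iff[OF I n(1)] by simp
  also have "\<ominus> n = e \<ominus> (e \<oplus> n)" using c n(1) by algebra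
  finally have "e = e \<oplus> n" by (rule lift_uniquely_mod_eq[OF lift I e n(5)])
  then have "n = \<ominus> e \<oplus> e" using c n(1) by (metis r_neg1)
  then show "e \<otimes> r \<otimes> (\<one> \<ominus> e) = \<zero>" using c by (simp add: n_def l_neg)
qed

context idem_central_ring
begin

text \<open>The exchange idempotent for x lies in xR, hence in I, and so is zero. Exchange then
  yields a right inverse of 1 - x, which suffices when idempotents are central.\<close>

lemma one_minus_Units_of_exchange:
  assumes exch: "exchange_ring R" and I: "ideal I R"
    and no_idem: "\<And>e. e \<in> idempotents R \<Longrightarrow> e \<in> I \<Longrightarrow> e = \<zero>"
    and x: "x \<in> I"
  shows "\<one> \<ominus> x \<in> Units R"
proof -
  interpret I: ideal I R by fact
  have c: "x \<in> carrier R" using x by (rule I.Icarr)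
  with exch obtain e where e: "e \<in> idempotents R" "e \<in> x <# carrier R"
      "\<one> \<ominus> e \<in> (\<one> \<ominus> x) <# carrier R"
    unfolding exchange_ring_def by blast
  then have "e \<in> I" using x by (auto elim!: principal_right_idealE intro: I.I_r_closed)
  then have "e = \<zero>" using e(1) by (intro no_idem)
  then have "\<one> \<in> (\<one> \<ominus> x) <# carrier R" using e(3) by (simp add: a_minus_def)
  then obtain s where "s \<in> carrier R" "\<one> = (\<one> \<ominus> x) \<otimes> s" by (rule principal_right_idealE)
  then show ?thesis using c by (intro right_inverse_imp_Units[of _ s]) auto
qed

lemma exchange_potent_lift_imp_uniquely_pi_clean:
  assumes exch: "exchange_ring R" and I: "ideal I R" and potent: "potent_ring (R Quot I)"
    and lift: "idempotents_lift_uniquely_mod R I"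
  shows "uniquely_pi_clean_ring R"
  unfolding uniquely_pi_clean_ring_def
proof (intro conjI ballI ring_axioms)
  interpret I: ideal I R by fact
  interpret Q: ring_hom_ring R "R Quot I" "(+>) I" by (rule I.rcos_ring_hom_ring)
  have no_idem: "e = \<zero>" if "e \<in> idempotents R" "e \<in> I" for e
    using that by (intro lift_uniquely_mod_eq[OF lift I])
      (auto simp: idempotents_def a_minus_def)
  \<comment> \<open>Units are stable under congruence modulo I: w is v times 1 - v^(-1)(v - w), and
    that factor is a unit.\<close>
  have unit_cong: "w \<in> Units R" if v: "v \<in> Units R" and w: "w \<in> carrier R" and d: "v \<ominus> w \<in> I" for v w
  proof -
    have c: "v \<in> carrier R" "inv v \<in> carrier R" using v by auto
    have "\<one> \<ominus> inv v \<otimes> (v \<ominus> w) \<in> Units R"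
      by (rule one_minus_Units_of_exchange[OF exch I no_idem I.I_l_closed[OF d c(2)]])
    then have "v \<otimes> (\<one> \<ominus> inv v \<otimes> (v \<ominus> w)) \<in> Units R" using v by (rule Units_m_closed[rotated])
    also have "v \<otimes> (\<one> \<ominus> inv v \<otimes> (v \<ominus> w)) = v \<ominus> (v \<otimes> inv v) \<otimes> (v \<ominus> w)" using c w by algebra
    also have "\<dots> = v \<ominus> (v \<ominus> w)" using v c w by simp
    also have "\<dots> = w" using c w by algebra
    finally show ?thesis .
  qed
  fix a assume a: "a \<in> carrier R"
  define A where "A = I +> a"
  have A: "A \<in> carrier (R Quot I)" using a by (simp add: A_def)
  then obtain k :: nat where k: "k \<ge> 2" "A [^]\<^bsub>R Quot I\<^esub> k = A"
    using potent unfolding potent_ring_def by blast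
  \<comment> \<open>With k = j + 2 the exponent used is m = j + 1 = k - 1. Since 2m = k + j, the
    power A^(2m) equals A A^j = A^m, so a^m is idempotent modulo I.\<close>
  then obtain j where j: "k = Suc (Suc j)" by (metis One_nat_def Suc_1 Suc_le_D Suc_le_mono)
  let ?m = "Suc j"
  define x where "x = a [^] ?m"
  have x: "x \<in> carrier R" using a by (simp add: x_def)
  have "A [^]\<^bsub>R Quot I\<^esub> (?m + ?m) = A [^]\<^bsub>R Quot I\<^esub> k \<otimes>\<^bsub>R Quot I\<^esub> A [^]\<^bsub>R Quot I\<^esub> j"
    unfolding Q.S.nat_pow_mult[OF A] j by simp
  also have "\<dots> = A [^]\<^bsub>R Quot I\<^esub> ?m" unfolding k(2) by (rule Q.S.nat_pow_Suc2[OF A, symmetric])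
  finally have "A [^]\<^bsub>R Quot I\<^esub> (?m + ?m) = A [^]\<^bsub>R Quot I\<^esub> ?m" .
  then have "I +> a [^] ?m = I +> a [^] (?m + ?m)" unfolding A_def Q.hom_nat_pow[OF a] by simp
  moreover have "a [^] (?m + ?m) = x [^] (2::nat)"
    unfolding x_def nat_pow_mult[OF a, symmetric] using a by (simp add: numeral_2_eq_2)
  ultimately have "x \<ominus> x [^] (2::nat) \<in> I"
    using quotient_eq_iff_same_a_r_cos[OF I x, of "x [^] (2::nat)"] x by (simp add: x_def)
  then obtain f where f: "f \<in> idempotents R" "x \<ominus> f \<in> I"
    using lift x unfolding idempotents_lift_uniquely_mod_def by blast
  have fc: "f \<in> carrier R" using f(1) by (rule idempotents_carrier)
  have "uniquely_clean R x"
  proof (rule uniquely_cleanI)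
    show "\<one> \<ominus> f \<in> idempotents R" by (rule idempotents_compl[OF f(1)])
    show "x = (\<one> \<ominus> f) \<oplus> (x \<ominus> (\<one> \<ominus> f))" using x fc by algebra
    \<comment> \<open>As x is congruent to f, the candidate unit is congruent to 2f - 1, which is
      invertible.\<close>
    have "(f \<ominus> (\<one> \<ominus> f)) \<ominus> (x \<ominus> (\<one> \<ominus> f)) = \<ominus> (x \<ominus> f)" using x fc by algebra
    then show "x \<ominus> (\<one> \<ominus> f) \<in> Units R"
      using x fc I.a_inv_closed[OF f(2)]
      by (intro unit_cong[OF idempotent_symmetry(2)[OF f(1)]]) auto
    fix g v assume g: "g \<in> idempotents R" "v \<in> Units R" "x = g \<oplus> v"
    have gc: "g \<in> carrier R" "v \<in> carrier R" "inv v \<in> carrier R"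
      using g by (auto simp: idempotents_def)
    have v: "v = x \<ominus> g" unfolding g(3) using gc by algebra
    text \<open>Multiplying \<open>f \<ominus> g \<equiv> v\<close> by \<open>p = f \<otimes> g\<close> or by \<open>p = (\<one> \<ominus> f) \<otimes> (\<one> \<ominus> g)\<close> kills
      the left side, so the idempotent \<open>p\<close> lies in \<open>I\<close>.\<close>
    have vanish: "p = \<zero>" if p: "p \<in> idempotents R" and pfg: "p \<otimes> f = p \<otimes> g" for p
    proof (rule no_idem[OF p])
      have pc: "p \<in> carrier R" using p by (rule idempotents_carrier)
      have "p \<otimes> v = p \<otimes> (x \<ominus> f) \<oplus> (p \<otimes> f \<ominus> p \<otimes> g)" unfolding v using pc x fc gc(1) by algebra
      also have "\<dots> = p \<otimes> (x \<ominus> f)" unfolding pfg using pc x fc gc(1) by (simp add: a_minus_def r_neg)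
      finally have "p \<otimes> v \<in> I" using I.I_l_closed[OF f(2) pc] by simp
      then have "p \<otimes> v \<otimes> inv v \<in> I" using gc(3) by (rule I.I_r_closed)
      then show "p \<in> I" using pc gc g(2) by (simp add: m_assoc)
    qed
    have fg: "g \<otimes> f = f \<otimes> g" using idem_comm[OF g(1) fc] .
    have "f \<otimes> g = \<zero>"
    proof (rule vanish[OF idempotents_mult[OF f(1) g(1)]])
      have "f \<otimes> g \<otimes> f = f \<otimes> f \<otimes> g" using fc gc(1) fg by (simp add: m_assoc)
      then show "f \<otimes> g \<otimes> f = f \<otimes> g \<otimes> g"
        using fc gc(1) idempotents_square[OF f(1)] idempotents_square[OF g(1)] by (simp add: m_assoc)
    qed
    moreover have "(\<one> \<ominus> f) \<otimes> (\<one> \<ominus> g) = \<zero>"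
    proof (rule vanish[OF idempotents_mult[OF idempotents_compl[OF f(1)] idempotents_compl[OF g(1)]]])
      have "(\<one> \<ominus> f) \<otimes> (\<one> \<ominus> g) \<otimes> f = (\<one> \<ominus> f) \<otimes> f \<oplus> f \<otimes> (g \<otimes> f) \<ominus> g \<otimes> f"
        using fc gc(1) by algebra
      also have "\<dots> = f \<otimes> f \<otimes> g \<ominus> f \<otimes> g"
        unfolding idempotents_mult_compl[OF f(1)] fg using fc gc(1) by algebra
      also have "\<dots> = \<zero>"
        unfolding idempotents_square[OF f(1)] using fc gc(1) by (simp add: a_minus_def r_neg)
      moreover have "(\<one> \<ominus> f) \<otimes> (\<one> \<ominus> g) \<otimes> g = \<zero>"
        using fc gc(1) idempotents_mult_compl(2)[OF g(1)] by (simp add: m_assoc)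
      ultimately show "(\<one> \<ominus> f) \<otimes> (\<one> \<ominus> g) \<otimes> f = (\<one> \<ominus> f) \<otimes> (\<one> \<ominus> g) \<otimes> g" by simp
    qed
    \<comment> \<open>Once fg and (1-f)(1-g) vanish, this identity shows that g is the complement of
      f.\<close>
    moreover have "g = (\<one> \<ominus> f) \<ominus> (\<one> \<ominus> f) \<otimes> (\<one> \<ominus> g) \<oplus> f \<otimes> g" using fc gc(1) by algebra
    ultimately have "g = \<one> \<ominus> f" using fc by (simp add: a_minus_def)
    then show "g = \<one> \<ominus> f \<and> v = x \<ominus> (\<one> \<ominus> f)" using v by simp
  qed
  then show "\<exists>n::nat. n \<ge> 1 \<and> uniquely_clean R (a [^] n)"
    unfolding x_def by (intro exI[of _ ?m]) simp
qed

end

theorem theorem3p7: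
  fixes R :: "('a, 'm) ring_scheme"
  assumes "ring R"
  shows "uniquely_pi_clean_ring R \<longleftrightarrow>
    exchange_ring R \<and>
    (potent_ring (R Quot (Jstar R)) \<and> idempotents_lift_uniquely_mod R (Jstar R))"
proof -
  interpret ring R by fact
  show ?thesis
  proof
    assume upc: "uniquely_pi_clean_ring R"
    then interpret idem_central_ring R by (rule uniquely_pi_clean_imp_idem_central)
    show "exchange_ring R \<and>
      (potent_ring (R Quot (Jstar R)) \<and> idempotents_lift_uniquely_mod R (Jstar R))"
      using upc uniquely_pi_clean_imp_exchange uniquely_pi_clean_imp_potent_quot
        exchange_imp_idempotents_lift_uniquely_mod_Jstar by blast
  next
    assume h: "exchange_ring R \<and>
      (potent_ring (R Quot (Jstar R)) \<and> idempotents_lift_uniquely_mod R (Jstar R))"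
    then interpret idem_central_ring R by (intro potent_lift_imp_idem_central[OF ideal_Jstar]) auto
    show "uniquely_pi_clean_ring R"
      using h by (intro exchange_potent_lift_imp_uniquely_pi_clean[OF _ ideal_Jstar]) auto
  qed
qed

end
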